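(* Let $R$ be an $(SU)_2$ ring. Then $R$ is an elementary divisor ring if for all $(a,b,c)\in Um(R^3)$ there exists $(e,f)\in R^2$ such that $(ae^2-cf^2,\,ac-b^2)\in Um(R^2)$, and the converse holds if $R$ has characteristic $2$.
   Context: Rings are commutative with identity. $Um(R^n)$ is the set of $n$-tuples generating the unit ideal of $R$. $R$ is an $(SU)_2$ ring if for each $A\in\mathbb{M}_2(R)$ there exists $N\in GL_2(R)$ such that $AN$ is symmetric. $R$ is an elementary divisor ring if for all $m,n\ge 1$ each $m\times n$ matrix over $R$ is equivalent (via multiplication by invertible matrices on the left and right) to a matrix whose off-diagonal entries are $0$ and whose diagonal entries $a_{1,1},\ldots,a_{s,s}$, $s=\min\{m,n\}$, satisfy $a_{i,i}\mid a_{i+1,i+1}$ for $1\le i\le s-1$. *)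

theory Defs
  imports "Jordan_Normal_Form.Matrix"
begin

text \<open>
  The ideal generated by the entries is the span of the entries in the ring,
  regarded as a module over itself.
\<close>

definition Um :: "nat \<Rightarrow> 'a::comm_ring_1 vec set" where
  "Um n = {v \<in> carrier_vec n. Modules.module.span ((*) :: 'a \<Rightarrow> 'a \<Rightarrow> 'a) (set\<^sub>v v) = UNIV}"

definition GL :: "nat \<Rightarrow> 'a::comm_ring_1 mat set" where
  "GL n = {A \<in> carrier_mat n n. invertible_mat A}"

definition symmetric_mat :: "'a mat \<Rightarrow> bool" where
  "symmetric_mat A \<longleftrightarrow> transpose_mat A = A"

definition SU2_ring :: "'a::comm_ring_1 itself \<Rightarrow> bool" where
  "SU2_ring (_ :: 'a itself) \<longleftrightarrow>
     (\<forall>A \<in> carrier_mat 2 2. \<exists>N \<in> (GL 2 :: 'a mat set). symmetric_mat (A * N))"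

definition equivalent_mat :: "'a::comm_ring_1 mat \<Rightarrow> 'a mat \<Rightarrow> bool" where
  "equivalent_mat A B \<longleftrightarrow>
     (\<exists>P \<in> GL (dim_row A). \<exists>Q \<in> GL (dim_col A). B = P * A * Q)"

definition elementary_divisor_ring :: "'a::comm_ring_1 itself \<Rightarrow> bool" where
  "elementary_divisor_ring (_ :: 'a itself) \<longleftrightarrow>
     (\<forall>m \<ge> 1. \<forall>n \<ge> 1. \<forall>A \<in> (carrier_mat m n :: 'a mat set).
        \<exists>D. equivalent_mat A D \<and> diagonal_mat D \<and>
            (\<forall>i. i + 1 < min m n \<longrightarrow> D $$ (i, i) dvd D $$ (i + 1, i + 1)))"

end

(*
Symmetrizing a matrix with zero second row shows that an (SU)_2 ring is a Hermite ring. By Kaplansky,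
a Hermite ring is an elementary divisor ring as soon as every unimodular 2x2 matrix A has a
unimodular row (p, q) with (p, q)A unimodular, and for A it suffices to treat a symmetric AN with
entries a, b, c. If (r, s) = (e, f)(AN), then a e^2 - c f^2 = e r - f s. Writing (e, f) = g (p, q)
with (p, q) unimodular, this element lies in the ideal of (p, q)(AN), which also contains the
determinant ac - b^2; so this ideal is the whole ring. Conversely, in characteristic 2 and with
d = a e^2 - c f^2, modulo the determinant one has r^2 = a d and s^2 = c d, so r, s unimodular
forces d to be invertible modulo the determinant.
*)

theory Submission
  imports Defs
begin

section \<open>Unimodular tuples as Bezout identities, and inverses of square matrices\<close>

definition coprime_pair :: "'a::comm_ring_1 \<Rightarrow> 'a \<Rightarrow> bool" where
  "coprime_pair a b \<longleftrightarrow> (\<exists>x y. x * a + y * b = 1)"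

lemma module_mult: "Modules.module ((*) :: 'a::comm_ring_1 \<Rightarrow> 'a \<Rightarrow> 'a)"
  by unfold_locales (simp_all add: algebra_simps)

text \<open>These peel off one generator at a time until only the zero span of the empty set
  remains, so that membership of 1 becomes a Bezout identity.\<close>

lemmas span_mult_insert = Modules.module.span_breakdown_eq[OF module_mult]
lemmas span_mult_empty = Modules.module.span_empty[OF module_mult]

text \<open>An ideal containing 1 is everything, since every element is a multiple of 1.\<close>

lemma Um_vec_of_list_iff:
  "vec_of_list xs \<in> Um n \<longleftrightarrow>
     length xs = n \<and> (1 :: 'a::comm_ring_1) \<in> Modules.module.span (*) (set xs)"
proof -
  have "set\<^sub>v (vec_of_list xs) = set xs"
    by (metis list_vec set_list_of_vec)
  moreover have "vec_of_list xs \<in> carrier_vec n \<longleftrightarrow> length xs = n" by (simp only: carrier_vec_def mem_Collect_eq dim_vec_of_list)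
  moreover have "Modules.module.span (*) S = UNIV \<longleftrightarrow> (1 :: 'a) \<in> Modules.module.span (*) S" for S
    using Modules.module.span_scale[OF module_mult, of 1 S] by auto
  ultimately show ?thesis by (simp only: Um_def mem_Collect_eq)
qed

lemma Um2_iff: "vec_of_list [a, b] \<in> Um 2 \<longleftrightarrow> coprime_pair a (b :: 'a::comm_ring_1)"
proof -
  have span: "1 \<in> Modules.module.span (*) {a, b} \<longleftrightarrow> (\<exists>x y. 1 - x * a - y * b = 0)"
    unfolding span_mult_insert unfolding span_mult_empty singleton_iff by (rule refl)
  have cop: "(\<exists>x y. 1 - x * a - y * b = 0) \<longleftrightarrow> coprime_pair a b"
    unfolding coprime_pair_def diff_diff_add right_minus_eq by (intro iff_exI eq_commute)
  have len: "length [a, b] = 2" by simp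
  show ?thesis unfolding Um_vec_of_list_iff list.set span cop using len by blast
qed

lemma Um3_iff:
  "vec_of_list [a, b, c] \<in> Um 3 \<longleftrightarrow> (\<exists>x y z. x * a + y * b + z * c = (1 :: 'a::comm_ring_1))"
proof -
  have span: "1 \<in> Modules.module.span (*) {a, b, c} \<longleftrightarrow> (\<exists>x y z. 1 - x * a - y * b - z * c = 0)"
    unfolding span_mult_insert unfolding span_mult_empty singleton_iff by (rule refl)
  have cop: "(\<exists>x y z. 1 - x * a - y * b - z * c = 0) \<longleftrightarrow> (\<exists>x y z. x * a + y * b + z * c = 1)"
    unfolding diff_diff_add right_minus_eq by (intro iff_exI eq_commute)
  have len: "length [a, b, c] = 3" by simp
  show ?thesis unfolding Um_vec_of_list_iff list.set span cop using len by blast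
qed

text \<open>\<open>invertible_mat\<close> leaves the shape of the inverse open; comparing column
  counts in the two product identities forces it to be n by n.\<close>

lemma GL_inverse:
  assumes "N \<in> GL n"
  obtains M where "M \<in> carrier_mat n n" "N * M = 1\<^sub>m n" "M * N = 1\<^sub>m n"
proof -
  from assms obtain M where N: "N \<in> carrier_mat n n"
    and M: "N * M = 1\<^sub>m n" "M * N = 1\<^sub>m (dim_row M)"
    unfolding GL_def invertible_mat_def inverts_mat_def by auto
  have "dim_col M = n" using arg_cong[OF M(1), of dim_col] by simp
  moreover have "dim_row M = n" using arg_cong[OF M(2), of dim_col] N by simp
  ultimately have "M \<in> carrier_mat n n" by auto
  then show thesis using that M by auto
qed

lemma mult2_index:
  assumes "A \<in> carrier_mat 2 2" "B \<in> carrier_mat 2 2" "i < 2" "j < 2"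
  shows "(A * B) $$ (i, j) = A $$ (i, 0) * B $$ (0, j) + A $$ (i, 1) * B $$ (1, j)"
  using assms by (simp add: scalar_prod_def numeral_2_eq_2)

section \<open>Two by two matrices over an (SU)2 ring\<close>

text \<open>Entrywise form of S = AN and A = SM, where A has rows (a, b), (c, d), S has rows (x, y),
  (y, z), and M with entries \<open>m\<^sub>1\<close>, ..., \<open>m\<^sub>4\<close> is the inverse
  of N. The last equation is the upper left entry of MN = 1. Later arguments thus become polynomial
  identities.\<close>

lemma SU2_symmetrize:
  fixes a b c d :: "'a::comm_ring_1"
  assumes "SU2_ring TYPE('a)"
  obtains x y z :: 'a and n\<^sub>1 n\<^sub>2 n\<^sub>3 n\<^sub>4 m\<^sub>1 m\<^sub>2 m\<^sub>3 m\<^sub>4 :: 'a where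
    "a * n\<^sub>1 + b * n\<^sub>3 = x" "a * n\<^sub>2 + b * n\<^sub>4 = y" "c * n\<^sub>1 + d * n\<^sub>3 = y" "c * n\<^sub>2 + d * n\<^sub>4 = z"
    "x * m\<^sub>1 + y * m\<^sub>3 = a" "x * m\<^sub>2 + y * m\<^sub>4 = b" "y * m\<^sub>1 + z * m\<^sub>3 = c" "y * m\<^sub>2 + z * m\<^sub>4 = d"
    "m\<^sub>1 * n\<^sub>1 + m\<^sub>2 * n\<^sub>3 = 1"
proof -
  define A where "A = mat 2 2 (\<lambda>(i, j). if i = 0 then (if j = 0 then a else b) else (if j = 0 then c else d))"
  have A: "A \<in> carrier_mat 2 2" unfolding A_def by simp
  have Ai: "A $$ (0,0) = a" "A $$ (0,1) = b" "A $$ (1,0) = c" "A $$ (1,1) = d"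
    unfolding A_def by simp_all
  obtain N where N: "N \<in> GL 2" and sym: "symmetric_mat (A * N)"
    using assms A unfolding SU2_ring_def by blast
  obtain M where M: "M \<in> carrier_mat 2 2" "N * M = 1\<^sub>m 2" "M * N = 1\<^sub>m 2"
    using GL_inverse[OF N] .
  have N': "N \<in> carrier_mat 2 2" using N unfolding GL_def by simp
  define S where "S = A * N"
  have S: "S \<in> carrier_mat 2 2" unfolding S_def using A N' by simp
  have S10: "S $$ (1,0) = S $$ (0,1)"
  proof -
    have "transpose_mat S = S" using sym unfolding symmetric_mat_def S_def .
    moreover have "transpose_mat S $$ (1,0) = S $$ (0,1)" using S by simp
    ultimately show ?thesis by simp
  qed
  have SM: "S * M = A"
    unfolding S_def using A N' M by (simp add: assoc_mult_mat[of _ 2 2 _ 2 _ 2])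
  note AN = mult2_index[OF A N', folded S_def]
  note SM' = mult2_index[OF S M(1), unfolded SM]
  note MN = mult2_index[OF M(1) N', unfolded M(3)]
  show thesis
    \<comment> \<open>The instances follow the order in which the variables first occur in the
      equations.\<close>
    by (rule that[of "N $$ (0,0)" "N $$ (1,0)" "S $$ (0,0)" "N $$ (0,1)" "N $$ (1,1)" "S $$ (0,1)"
          "S $$ (1,1)" "M $$ (0,0)" "M $$ (1,0)" "M $$ (0,1)" "M $$ (1,1)"])
      (use AN[of 0 0] AN[of 0 1] AN[of 1 0] AN[of 1 1] SM'[of 0 0] SM'[of 0 1] SM'[of 1 0]
         SM'[of 1 1] MN[of 0 0] S10 in \<open>simp_all add: Ai del: One_nat_def\<close>)
qed

text \<open>Kaplansky's Hermite rings: every row (a, b) reduces to (g, 0) by an invertible matrix. A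
  unimodular pair completes to a matrix of determinant one, which gives this factored form.\<close>

definition hermite :: "'a::comm_ring_1 itself \<Rightarrow> bool" where
  "hermite _ \<longleftrightarrow> (\<forall>a b :: 'a. \<exists>g a' b'. a = g * a' \<and> b = g * b' \<and> coprime_pair a' b')"

lemma SU2_imp_hermite:
  assumes "SU2_ring TYPE('a::comm_ring_1)"
  shows "hermite TYPE('a)"
  unfolding hermite_def
proof (intro allI)
  fix a b :: 'a
  \<comment> \<open>A symmetric matrix with zero second row has only its upper left entry.\<close>
  obtain x y z n\<^sub>1 n\<^sub>2 n\<^sub>3 n\<^sub>4 m\<^sub>1 m\<^sub>2 m\<^sub>3 m\<^sub>4 :: 'a where
    "0 * n\<^sub>1 + 0 * n\<^sub>3 = y" "x * m\<^sub>1 + y * m\<^sub>3 = a" "x * m\<^sub>2 + y * m\<^sub>4 = b"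
    "m\<^sub>1 * n\<^sub>1 + m\<^sub>2 * n\<^sub>3 = 1"
    using SU2_symmetrize[OF assms, of a b 0 0] by metis
  \<comment> \<open>As y = 0, the row (a, b) is x times the first row of the inverse of N, and that
    row is unimodular.\<close>
  then have "a = x * m\<^sub>1" "b = x * m\<^sub>2" "n\<^sub>1 * m\<^sub>1 + n\<^sub>3 * m\<^sub>2 = 1"
    by (auto simp: mult.commute)
  then show "\<exists>g a' b'. a = g * a' \<and> b = g * b' \<and> coprime_pair a' b'"
    unfolding coprime_pair_def by blast
qed

lemma symmetric_unimodular_combination:
  fixes a b c e f :: "'a::comm_ring_1"
  assumes H: "hermite TYPE('a)"
    and cop: "coprime_pair (a * e^2 - c * f^2) (a * c - b^2)"
  shows "\<exists>p q. coprime_pair p q \<and> coprime_pair (p * a + q * b) (p * b + q * c)"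
proof -
  obtain g p q where e: "e = g * p" and f: "f = g * q" and pq: "coprime_pair p q"
    using H unfolding hermite_def by blast
  obtain u v where uv: "u * p + v * q = 1" using pq unfolding coprime_pair_def by blast
  obtain \<alpha> \<beta> where ab: "\<alpha> * (a * e^2 - c * f^2) + \<beta> * (a * c - b^2) = 1"
    using cop unfolding coprime_pair_def by blast
  define r where "r = p * a + q * b"
  define s where "s = p * b + q * c"
  \<comment> \<open>The terms in b cancel in p r - q s, leaving a p^2 - c q^2.\<close>
  have 1: "a * e^2 - c * f^2 = g^2 * (p * r - q * s)"
    unfolding e f r_def s_def by (simp add: algebra_simps power2_eq_square)
  \<comment> \<open>The row (r, s) times the adjugate of the symmetric matrix is the determinant
    times (p, q); this is paired with (u, v).\<close>
  have "(a * c - b^2) * (u * p + v * q) = (u * c - v * b) * r + (v * a - u * b) * s"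
    unfolding r_def s_def by (simp add: algebra_simps power2_eq_square)
  then have 2: "a * c - b^2 = (u * c - v * b) * r + (v * a - u * b) * s" using uv by simp
  have "(\<alpha> * g^2 * p + \<beta> * (u * c - v * b)) * r + (\<beta> * (v * a - u * b) - \<alpha> * g^2 * q) * s = 1"
    using ab unfolding 1 2 by (simp add: algebra_simps)
  then show ?thesis using pq unfolding coprime_pair_def r_def s_def by blast
qed

text \<open>Kaplansky's condition for a Hermite ring to be an elementary divisor ring.\<close>
definition kaplansky_cond :: "'a::comm_ring_1 itself \<Rightarrow> bool" where
  "kaplansky_cond _ \<longleftrightarrow> (\<forall>a b d :: 'a. (\<exists>x y z. x * a + y * b + z * d = 1) \<longrightarrow>
     (\<exists>p q. coprime_pair p q \<and> coprime_pair (p * a) (p * b + q * d)))"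

text \<open>Kaplansky's condition asks for a unimodular row (p, q) whose product with the matrix A
  with rows (a, b), (0, d) is unimodular. For symmetric S = AN, unimodularity of the entries passes
  from A to S because A is S times the inverse of N. A good row for S is good for A because (p, q)S
  = ((p, q)A)N.\<close>

lemma SU2_imp_kaplansky_cond:
  assumes SU: "SU2_ring TYPE('a::comm_ring_1)"
    and hyp: "\<And>a b c :: 'a. \<exists>x y z. x * a + y * b + z * c = 1 \<Longrightarrow>
                \<exists>e f. coprime_pair (a * e^2 - c * f^2) (a * c - b^2)"
  shows "kaplansky_cond TYPE('a)"
  unfolding kaplansky_cond_def
proof (intro allI impI)
  fix a b d :: 'a
  assume "\<exists>x y z. x * a + y * b + z * d = 1"
  then obtain \<alpha> \<beta> \<gamma> where one: "\<alpha> * a + \<beta> * b + \<gamma> * d = 1" by blast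
  obtain x y z n\<^sub>1 n\<^sub>2 n\<^sub>3 n\<^sub>4 m\<^sub>1 m\<^sub>2 m\<^sub>3 m\<^sub>4 :: 'a where
    n: "a * n\<^sub>1 + b * n\<^sub>3 = x" "a * n\<^sub>2 + b * n\<^sub>4 = y" "0 * n\<^sub>1 + d * n\<^sub>3 = y" "0 * n\<^sub>2 + d * n\<^sub>4 = z"
    and m: "x * m\<^sub>1 + y * m\<^sub>3 = a" "x * m\<^sub>2 + y * m\<^sub>4 = b" "y * m\<^sub>1 + z * m\<^sub>3 = 0" "y * m\<^sub>2 + z * m\<^sub>4 = d"
    using SU2_symmetrize[OF SU, of a b 0 d] by metis
  have "(\<alpha> * m\<^sub>1 + \<beta> * m\<^sub>2) * x + (\<alpha> * m\<^sub>3 + \<beta> * m\<^sub>4 + \<gamma> * m\<^sub>2) * y + \<gamma> * m\<^sub>4 * z = 1"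
    using one unfolding m(1,2,4)[symmetric] by (simp add: algebra_simps)
  then obtain e f where ef: "coprime_pair (x * e^2 - z * f^2) (x * z - y^2)"
    using hyp[of x y z] by blast
  obtain p q where pq: "coprime_pair p q" and "coprime_pair (p * x + q * y) (p * y + q * z)"
    using symmetric_unimodular_combination[OF SU2_imp_hermite[OF SU] ef] by blast
  then obtain s t where "s * (p * x + q * y) + t * (p * y + q * z) = 1"
    unfolding coprime_pair_def by blast
  moreover have "p * x + q * y = n\<^sub>1 * (p * a) + n\<^sub>3 * (p * b + q * d)"
    unfolding n(1)[symmetric] n(3)[symmetric] by (simp add: algebra_simps)
  moreover have "p * y + q * z = n\<^sub>2 * (p * a) + n\<^sub>4 * (p * b + q * d)"
    unfolding n(2)[symmetric] n(4)[symmetric] by (simp add: algebra_simps)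
  ultimately have "(s * n\<^sub>1 + t * n\<^sub>2) * (p * a) + (s * n\<^sub>3 + t * n\<^sub>4) * (p * b + q * d) = 1"
    by (simp add: algebra_simps)
  then show "\<exists>p q. coprime_pair p q \<and> coprime_pair (p * a) (p * b + q * d)"
    using pq unfolding coprime_pair_def by blast
qed

section \<open>The converse in characteristic two\<close>

text \<open>Diagonalize the matrix A with rows (a, b), (b, c) as D = PAQ. The first diagonal entry
  divides all of D, hence all entries of A, so it is a unit. Therefore the first row (e, f) of P has
  a unimodular product (r, s) with A.\<close>

lemma char2_converse:
  fixes a b c :: "'a::comm_ring_1"
  assumes ch: "CHAR('a) = 2" and ed: "elementary_divisor_ring TYPE('a)"
    and "\<exists>x y z. x * a + y * b + z * c = 1"
  shows "\<exists>e f. coprime_pair (a * e^2 - c * f^2) (a * c - b^2)"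
proof -
  have two: "2 = (0::'a)" using of_nat_CHAR[where 'a = 'a] ch by simp
  obtain x y z where xyz: "x * a + y * b + z * c = 1" using assms(3) by blast
  define A where "A = mat 2 2 (\<lambda>(i, j). if i = 0 then (if j = 0 then a else b) else (if j = 0 then b else c))"
  have A: "A \<in> carrier_mat 2 2" unfolding A_def by simp
  have Ai: "A $$ (0,0) = a" "A $$ (0,1) = b" "A $$ (1,0) = b" "A $$ (1,1) = c"
    unfolding A_def by simp_all
  obtain P Q D where P: "P \<in> GL 2" and Q: "Q \<in> GL 2" and D: "D = P * A * Q" "diagonal_mat D"
    and dv: "D $$ (0,0) dvd D $$ (1,1)"
  proof -
    have "\<exists>D. equivalent_mat A D \<and> diagonal_mat D \<and>
            (\<forall>i. i + 1 < min 2 2 \<longrightarrow> D $$ (i, i) dvd D $$ (i + 1, i + 1))"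
      using ed A unfolding elementary_divisor_ring_def
      by (metis one_le_numeral)
    then show thesis using that A unfolding equivalent_mat_def by fastforce
  qed
  obtain P' where P': "P' \<in> carrier_mat 2 2" "P' * P = 1\<^sub>m 2" using GL_inverse[OF P] by metis
  obtain Q' where Q': "Q' \<in> carrier_mat 2 2" "Q * Q' = 1\<^sub>m 2" using GL_inverse[OF Q] by metis
  have PC: "P \<in> carrier_mat 2 2" and QC: "Q \<in> carrier_mat 2 2" using P Q unfolding GL_def by auto
  have PA: "P * A \<in> carrier_mat 2 2" using PC A by simp
  have DC: "D \<in> carrier_mat 2 2" using D PA QC by simp
  have "D * Q' = P * A"
    using D(1) PA QC Q' by (simp add: assoc_mult_mat[of _ 2 2 _ 2 _ 2] right_mult_one_mat[OF PA])
  moreover have "P' * (P * A) = A"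
    using PC A P' by (simp add: assoc_mult_mat[of _ 2 2 _ 2 _ 2, symmetric])
  ultimately have AD: "P' * (D * Q') = A" by simp
  have DQ: "D * Q' \<in> carrier_mat 2 2" using DC Q' by simp
  define d where "d = D $$ (0,0)"
  have D01: "D $$ (0,1) = 0" "D $$ (1,0) = 0" using D(2) DC unfolding diagonal_mat_def by auto
  have dD: "d dvd (D * Q') $$ (i, j)" if "i < 2" "j < 2" for i j
  proof -
    have "i = 0 \<or> i = 1" using that by auto
    then show ?thesis using dv that D01
      by (auto simp: mult2_index[OF DC Q'(1)] d_def simp del: One_nat_def)
  qed
  have dA: "d dvd A $$ (i, j)" if "i < 2" "j < 2" for i j
  proof -
    have "A $$ (i, j) = P' $$ (i, 0) * (D * Q') $$ (0, j) + P' $$ (i, 1) * (D * Q') $$ (1, j)"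
      using mult2_index[OF P'(1) DQ that] AD by simp
    then show ?thesis using that by (simp add: dD)
  qed
  have "d dvd 1"
    unfolding xyz[symmetric] using dA[of 0 0] dA[of 0 1] dA[of 1 1] by (simp add: Ai del: One_nat_def)
  then obtain d' where d': "d * d' = 1" by (metis dvdE)
  define e where "e = P $$ (0,0)"
  define f where "f = P $$ (0,1)"
  define r where "r = e * a + f * b"
  define s where "s = e * b + f * c"
  define u where "u = d' * Q $$ (0,0)"
  define v where "v = d' * Q $$ (1,0)"
  have "d = r * Q $$ (0,0) + s * Q $$ (1,0)"
    unfolding d_def D(1) r_def s_def e_def f_def
    using mult2_index[OF PA QC, of 0 0] mult2_index[OF PC A, of 0 0] mult2_index[OF PC A, of 0 1]
    by (simp add: Ai del: One_nat_def)
  then have "d * d' = u * r + v * s" by (simp add: u_def v_def algebra_simps)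
  then have uv: "u * r + v * s = 1" using d' by simp
  define q where "q = a * e^2 - c * f^2"
  define \<Delta> where "\<Delta> = a * c - b^2"
  \<comment> \<open>In characteristic two, squaring is additive and signs do not matter.\<close>
  have r2: "r^2 = a * q - f^2 * \<Delta>"
  proof -
    have "r^2 = a * q - f^2 * \<Delta> + 2 * (a * b * e * f + a * c * f^2)"
      unfolding r_def q_def \<Delta>_def by (simp add: algebra_simps power2_eq_square)
    then show ?thesis using two by simp
  qed
  have s2: "s^2 = c * q - e^2 * \<Delta>"
  proof -
    have "s^2 = c * q - e^2 * \<Delta> + 2 * (b * c * e * f + c^2 * f^2)"
      unfolding s_def q_def \<Delta>_def by (simp add: algebra_simps power2_eq_square)
    then show ?thesis using two by simp
  qed
  \<comment> \<open>Squaring the Bezout relation leaves only r^2 and s^2, which are a q and c q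
    modulo \<Delta>.\<close>
  have "(u * r + v * s)^2 = u^2 * r^2 + v^2 * s^2 + 2 * (u * r * v * s)" by (simp add: algebra_simps power2_eq_square)
  then have "u^2 * (a * q - f^2 * \<Delta>) + v^2 * (c * q - e^2 * \<Delta>) = 1"
    unfolding r2 s2 uv two by simp
  then have "(u^2 * a + v^2 * c) * q + (- (u^2 * f^2) - v^2 * e^2) * \<Delta> = 1" by (simp add: algebra_simps power2_eq_square)
  then show ?thesis unfolding coprime_pair_def q_def \<Delta>_def by blast
qed

section \<open>Elementary operations\<close>

text \<open>Matrices are handled here as functions of two indices. All operations act on two rows or two
  columns by a matrix of determinant one, on indices at least a bound \<open>k\<close>, so that the
  already diagonalized part stays in place and no block decompositions are needed.\<close>

definition row_op :: "nat \<Rightarrow> nat \<Rightarrow> 'a \<Rightarrow> 'a \<Rightarrow> 'a \<Rightarrow> 'a \<Rightarrow>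
    (nat \<Rightarrow> nat \<Rightarrow> 'a::comm_ring_1) \<Rightarrow> nat \<Rightarrow> nat \<Rightarrow> 'a" where
  "row_op i j p q r s A = (\<lambda>x y. if x = i then p * A i y + q * A j y
     else if x = j then r * A i y + s * A j y else A x y)"

text \<open>As a right multiplication, (p, q) and (r, s) are the columns of the acting two by two
  matrix, not its rows.\<close>

definition col_op :: "nat \<Rightarrow> nat \<Rightarrow> 'a \<Rightarrow> 'a \<Rightarrow> 'a \<Rightarrow> 'a \<Rightarrow>
    (nat \<Rightarrow> nat \<Rightarrow> 'a::comm_ring_1) \<Rightarrow> nat \<Rightarrow> nat \<Rightarrow> 'a" where
  "col_op i j p q r s A = (\<lambda>x y. if y = i then p * A x i + q * A x j
     else if y = j then r * A x i + s * A x j else A x y)"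

text \<open>Kept apart from \<open>reach\<close> because row operations never mix columns: zeros and
  divisibility survive in each column separately, and rows above \<open>k\<close> stay
  fixed.\<close>

inductive row_reach :: "nat \<Rightarrow> nat \<Rightarrow> (nat \<Rightarrow> nat \<Rightarrow> 'a::comm_ring_1) \<Rightarrow> (nat \<Rightarrow> nat \<Rightarrow> 'a) \<Rightarrow> bool"
  for m k :: nat and A :: "nat \<Rightarrow> nat \<Rightarrow> 'a::comm_ring_1" where
  refl: "row_reach m k A A"
| row: "row_reach m k A B \<Longrightarrow> k \<le> i \<Longrightarrow> i < m \<Longrightarrow> k \<le> j \<Longrightarrow> j < m \<Longrightarrow> i \<noteq> j \<Longrightarrow> p * s - q * r = 1
    \<Longrightarrow> row_reach m k A (row_op i j p q r s B)"

inductive reach :: "nat \<Rightarrow> nat \<Rightarrow> nat \<Rightarrow> (nat \<Rightarrow> nat \<Rightarrow> 'a::comm_ring_1) \<Rightarrow> (nat \<Rightarrow> nat \<Rightarrow> 'a) \<Rightarrow> bool"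
  for m n k :: nat and A :: "nat \<Rightarrow> nat \<Rightarrow> 'a::comm_ring_1" where
  refl: "reach m n k A A"
| row: "reach m n k A B \<Longrightarrow> k \<le> i \<Longrightarrow> i < m \<Longrightarrow> k \<le> j \<Longrightarrow> j < m \<Longrightarrow> i \<noteq> j \<Longrightarrow> p * s - q * r = 1
    \<Longrightarrow> reach m n k A (row_op i j p q r s B)"
| col: "reach m n k A B \<Longrightarrow> k \<le> i \<Longrightarrow> i < n \<Longrightarrow> k \<le> j \<Longrightarrow> j < n \<Longrightarrow> i \<noteq> j \<Longrightarrow> p * s - q * r = 1
    \<Longrightarrow> reach m n k A (col_op i j p q r s B)"

text \<open>The later stretch is the first premise because the induction runs over it.\<close>

lemma reach_trans: "reach m n k B C \<Longrightarrow> reach m n k A B \<Longrightarrow> reach m n k A C"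
  by (induction rule: reach.induct) (auto intro: reach.intros)

lemma reach_mono: "reach m n k A B \<Longrightarrow> n \<le> n' \<Longrightarrow> k' \<le> k \<Longrightarrow> reach m n' k' A B"
  by (induction rule: reach.induct) (auto intro: reach.intros)

lemma row_reach_imp_reach: "row_reach m k A B \<Longrightarrow> k' \<le> k \<Longrightarrow> reach m n k' A B"
  by (induction rule: row_reach.induct) (auto intro: reach.intros)

lemma row_reach_above: "row_reach m k A B \<Longrightarrow> x < k \<Longrightarrow> B x y = A x y"
  by (induction rule: row_reach.induct) (auto simp: row_op_def)

text \<open>New entries of column \<open>y\<close> are combinations of old entries of that column.
  With \<open>d = 0\<close> this is preservation of zeros.\<close>

lemma row_reach_dvd:
  assumes "row_reach m k A B" "\<And>x. k \<le> x \<Longrightarrow> x < m \<Longrightarrow> d dvd A x y" "k \<le> x" "x < m"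
  shows "d dvd B x y"
  using assms(1,3,4) by (induction arbitrary: x rule: row_reach.induct) (auto simp: row_op_def assms(2))

lemma reach_dvd:
  assumes "reach m n k A B" "\<And>x y. k \<le> x \<Longrightarrow> x < m \<Longrightarrow> k \<le> y \<Longrightarrow> y < n \<Longrightarrow> d dvd A x y"
    "k \<le> x" "x < m" "k \<le> y" "y < n"
  shows "d dvd B x y"
  using assms(1,3-)
  by (induction arbitrary: x y rule: reach.induct) (auto simp: row_op_def col_op_def assms(2))

lemma reach_outside: "reach m n k A B \<Longrightarrow> x < k \<Longrightarrow> y < k \<Longrightarrow> B x y = A x y"
  by (induction rule: reach.induct) (auto simp: row_op_def col_op_def)

text \<open>Row operations miss a row above \<open>k\<close>, and column operations only combine its
  zeros.\<close>

lemma reach_zero_right: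
  assumes "reach m n k A B" "x < k" "\<And>y. k \<le> y \<Longrightarrow> y < n \<Longrightarrow> A x y = 0" "k \<le> y" "y < n"
  shows "B x y = 0"
  using assms(1,4,5)
  by (induction arbitrary: y rule: reach.induct) (use assms(2,3) in \<open>auto simp: row_op_def col_op_def\<close>)

lemma reach_zero_below:
  assumes "reach m n k A B" "y < k" "\<And>x. k \<le> x \<Longrightarrow> x < m \<Longrightarrow> A x y = 0" "k \<le> x" "x < m"
  shows "B x y = 0"
  using assms(1,4,5)
  by (induction arbitrary: x rule: reach.induct) (use assms(2,3) in \<open>auto simp: row_op_def col_op_def\<close>)

subsection \<open>Elementary operations and matrix equivalence\<close>

definition fmat :: "nat \<Rightarrow> nat \<Rightarrow> (nat \<Rightarrow> nat \<Rightarrow> 'a) \<Rightarrow> 'a mat" where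
  "fmat m n A = mat m n (\<lambda>(i, j). A i j)"

lemma fmat_carrier [simp]: "fmat m n A \<in> carrier_mat m n"
  unfolding fmat_def by simp

text \<open>The identity matrix as a function; operations applied to it yield the elementary
  matrices.\<close>

definition delta :: "nat \<Rightarrow> nat \<Rightarrow> 'a::comm_ring_1" where
  "delta x y = (if x = y then 1 else 0)"

lemma fmat_delta: "fmat m m delta = 1\<^sub>m m"
  by (rule eq_matI) (auto simp: fmat_def delta_def)

lemma sum_delta_left: "x < m \<Longrightarrow> (\<Sum>l = 0..<m. delta x l * f l) = f x"
  by (simp add: delta_def if_distrib[of "\<lambda>t. t * _"] cong: if_cong)

lemma sum_delta_right: "x < m \<Longrightarrow> (\<Sum>l = 0..<m. f l * delta l x) = f x"
  by (simp add: delta_def if_distrib[of "\<lambda>t. _ * t"] cong: if_cong)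

lemma row_op_mult:
  assumes "i < m" "j < m"
  shows "fmat m m (row_op i j p q r s delta) * fmat m n A = fmat m n (row_op i j p q r s A)"
proof (rule eq_matI)
  fix x y assume "x < dim_row (fmat m n (row_op i j p q r s A))" "y < dim_col (fmat m n (row_op i j p q r s A))"
  then have xy: "x < m" "y < n" by (simp_all add: fmat_def)
  have "(fmat m m (row_op i j p q r s delta) * fmat m n A) $$ (x, y)
      = (\<Sum>l = 0..<m. row_op i j p q r s delta x l * A l y)"
    using xy by (simp add: fmat_def scalar_prod_def)
  also have "\<dots> = row_op i j p q r s A x y"
    using xy assms
    by (simp add: row_op_def distrib_right mult.assoc sum.distrib sum_distrib_left[symmetric] sum_delta_left)
  finally show "(fmat m m (row_op i j p q r s delta) * fmat m n A) $$ (x, y)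
      = fmat m n (row_op i j p q r s A) $$ (x, y)"
    using xy by (simp add: fmat_def)
qed (simp_all add: fmat_def)

lemma col_op_mult:
  assumes "i < n" "j < n"
  shows "fmat m n A * fmat n n (col_op i j p q r s delta) = fmat m n (col_op i j p q r s A)"
proof (rule eq_matI)
  fix x y assume "x < dim_row (fmat m n (col_op i j p q r s A))" "y < dim_col (fmat m n (col_op i j p q r s A))"
  then have xy: "x < m" "y < n" by (simp_all add: fmat_def)
  have "(fmat m n A * fmat n n (col_op i j p q r s delta)) $$ (x, y)
      = (\<Sum>l = 0..<n. A x l * col_op i j p q r s delta l y)"
    using xy by (simp add: fmat_def scalar_prod_def)
  also have "\<dots> = col_op i j p q r s A x y"
    using xy assms
    by (simp add: col_op_def distrib_left mult.left_commute[of "A x _"] sum.distrib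
        sum_distrib_left[symmetric] sum_delta_right)
  finally show "(fmat m n A * fmat n n (col_op i j p q r s delta)) $$ (x, y)
      = fmat m n (col_op i j p q r s A) $$ (x, y)"
    using xy by (simp add: fmat_def)
qed (simp_all add: fmat_def)

text \<open>The adjugate inverts a two by two matrix of determinant one.\<close>

lemma row_op_inverse:
  assumes "i \<noteq> j" "p * s - q * r = 1"
  shows "row_op i j s (- q) (- r) p (row_op i j p q r s A) = A"
proof (intro ext)
  fix x y
  have "s * (p * u + q * v) - q * (r * u + s * v) = (p * s - q * r) * u"
    "p * (r * u + s * v) - r * (p * u + q * v) = (p * s - q * r) * v" for u v
    by (simp_all add: algebra_simps)
  then show "row_op i j s (- q) (- r) p (row_op i j p q r s A) x y = A x y"
    using assms by (simp add: row_op_def)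
qed

lemma col_op_inverse:
  assumes "i \<noteq> j" "p * s - q * r = 1"
  shows "col_op i j s (- q) (- r) p (col_op i j p q r s A) = A"
proof (intro ext)
  fix x y
  have "s * (p * u + q * v) - q * (r * u + s * v) = (p * s - q * r) * u"
    "p * (r * u + s * v) - r * (p * u + q * v) = (p * s - q * r) * v" for u v
    by (simp_all add: algebra_simps)
  then show "col_op i j s (- q) (- r) p (col_op i j p q r s A) x y = A x y"
    using assms by (simp add: col_op_def)
qed

lemma GL_I:
  assumes "P \<in> carrier_mat n n" "P' \<in> carrier_mat n n" "P * P' = 1\<^sub>m n" "P' * P = 1\<^sub>m n"
  shows "P \<in> GL n"
  using assms unfolding GL_def invertible_mat_def inverts_mat_def by auto

lemma GL_mult:
  assumes "P \<in> GL n" "Q \<in> GL n"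
  shows "P * Q \<in> GL n"
proof -
  obtain P' where P': "P' \<in> carrier_mat n n" "P * P' = 1\<^sub>m n" "P' * P = 1\<^sub>m n"
    using GL_inverse[OF assms(1)] .
  obtain Q' where Q': "Q' \<in> carrier_mat n n" "Q * Q' = 1\<^sub>m n" "Q' * Q = 1\<^sub>m n"
    using GL_inverse[OF assms(2)] .
  have P: "P \<in> carrier_mat n n" and Q: "Q \<in> carrier_mat n n" using assms unfolding GL_def by auto
  have "P * Q * (Q' * P') = P * (Q * Q') * P'"
    using P Q P'(1) Q'(1) by (simp add: assoc_mult_mat[of _ n n _ n _ n])
  moreover have "Q' * P' * (P * Q) = Q' * (P' * P) * Q"
    using P Q P'(1) Q'(1) by (simp add: assoc_mult_mat[of _ n n _ n _ n])
  ultimately show ?thesis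
    using P Q P' Q' by (intro GL_I[of _ n "Q' * P'"]) auto
qed

lemma row_op_GL:
  assumes "i < m" "j < m" "i \<noteq> j" "p * s - q * r = 1"
  shows "fmat m m (row_op i j p q r s delta) \<in> GL m"
proof (rule GL_I)
  \<comment> \<open>The adjugate also has determinant one and its adjugate is the original matrix,
    which gives the other order of the product.\<close>
  have "s * p - (- q) * (- r) = 1" using assms(4) by (simp add: mult.commute)
  from row_op_inverse[OF assms(3) this]
  show "fmat m m (row_op i j p q r s delta) * fmat m m (row_op i j s (- q) (- r) p delta) = 1\<^sub>m m"
    by (simp add: row_op_mult assms(1,2) fmat_delta)
qed (simp_all add: row_op_mult row_op_inverse fmat_delta assms)

lemma col_op_GL:
  assumes "i < m" "j < m" "i \<noteq> j" "p * s - q * r = 1"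
  shows "fmat m m (col_op i j p q r s delta) \<in> GL m"
proof (rule GL_I)
  have "s * p - (- q) * (- r) = 1" using assms(4) by (simp add: mult.commute)
  from col_op_inverse[OF assms(3) this]
  show "fmat m m (col_op i j s (- q) (- r) p delta) * fmat m m (col_op i j p q r s delta) = 1\<^sub>m m"
    by (simp add: col_op_mult assms(1,2) fmat_delta)
qed (simp_all add: col_op_mult col_op_inverse fmat_delta assms)

text \<open>Elementary matrices of row operations accumulate in the left factor, those of column
  operations in the right factor.\<close>

lemma reach_equivalent:
  assumes "reach m n k A B"
  shows "equivalent_mat (fmat m n A) (fmat m n B)"
proof -
  have "\<exists>P\<in>GL m. \<exists>Q\<in>GL n. fmat m n B = P * fmat m n A * Q"
    using assms
  proof (induction rule: reach.induct)
    case refl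
    have "1\<^sub>m l \<in> GL l" for l by (rule GL_I[of _ _ "1\<^sub>m l"]) auto
    moreover have "fmat m n A = 1\<^sub>m m * fmat m n A * 1\<^sub>m n"
      using left_mult_one_mat[OF fmat_carrier] right_mult_one_mat[OF fmat_carrier] by metis
    ultimately show ?case by blast
  next
    case (row B i j p s q r)
    then obtain P Q where PQ: "P \<in> GL m" "Q \<in> GL n" "fmat m n B = P * fmat m n A * Q" by blast
    define E where "E = fmat m m (row_op i j p q r s delta)"
    have E: "E \<in> GL m" unfolding E_def using row by (intro row_op_GL) auto
    have "fmat m n (row_op i j p q r s B) = E * (P * fmat m n A * Q)"
      unfolding E_def PQ(3)[symmetric] using row by (simp add: row_op_mult)
    also have "\<dots> = (E * P) * fmat m n A * Q"
    proof -
      have c: "E \<in> carrier_mat m m" "P \<in> carrier_mat m m" "Q \<in> carrier_mat n n"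
        using E PQ(1,2) unfolding GL_def by auto
      have "E * P * fmat m n A = E * (P * fmat m n A)"
        by (rule assoc_mult_mat[OF c(1,2) fmat_carrier])
      moreover have "E * (P * fmat m n A) * Q = E * (P * fmat m n A * Q)"
        by (rule assoc_mult_mat[OF c(1) mult_carrier_mat[OF c(2) fmat_carrier] c(3)])
      ultimately show ?thesis by simp
    qed
    finally show ?case using GL_mult[OF E PQ(1)] PQ(2) by blast
  next
    case (col B i j p s q r)
    then obtain P Q where PQ: "P \<in> GL m" "Q \<in> GL n" "fmat m n B = P * fmat m n A * Q" by blast
    define E where "E = fmat n n (col_op i j p q r s delta)"
    have E: "E \<in> GL n" unfolding E_def using col by (intro col_op_GL) auto
    have "fmat m n (col_op i j p q r s B) = P * fmat m n A * Q * E"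
      unfolding E_def PQ(3)[symmetric] using col by (simp add: col_op_mult)
    also have "\<dots> = P * fmat m n A * (Q * E)"
    proof -
      have c: "P \<in> carrier_mat m m" "Q \<in> carrier_mat n n" "E \<in> carrier_mat n n"
        using E PQ(1,2) unfolding GL_def by auto
      show ?thesis
        by (rule assoc_mult_mat[OF mult_carrier_mat[OF c(1) fmat_carrier] c(2,3)])
    qed
    finally show ?case using GL_mult[OF PQ(2) E] PQ(1) by blast
  qed
  then show ?thesis unfolding equivalent_mat_def by (simp add: fmat_def)
qed

section \<open>Diagonal reduction\<close>

text \<open>Factor (a, b) through g first, then (g, c) through h, and multiply the Bezout
  relations.\<close>

lemma hermite_triple:
  assumes "hermite TYPE('a::comm_ring_1)"
  shows "\<exists>h a' b' c'. a = h * a' \<and> b = h * b' \<and> c = h * (c' :: 'a) \<and>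
           (\<exists>x y z. x * a' + y * b' + z * c' = 1)"
proof -
  obtain g a1 b1 x y where 1: "a = g * a1" "b = g * b1" "x * a1 + y * b1 = 1"
    using assms unfolding hermite_def coprime_pair_def by metis
  obtain h g1 c1 u v where 2: "g = h * g1" "c = h * c1" "u * g1 + v * c1 = 1"
    using assms unfolding hermite_def coprime_pair_def by metis
  have "u * x * (g1 * a1) + u * y * (g1 * b1) + v * c1 = u * g1 * (x * a1 + y * b1) + v * c1"
    by (simp add: algebra_simps)
  then have "u * x * (g1 * a1) + u * y * (g1 * b1) + v * c1 = 1" using 1(3) 2(3) by simp
  moreover have "a = h * (g1 * a1)" "b = h * (g1 * b1)" using 1 2 by (simp_all add: mult.assoc)
  ultimately show ?thesis using 2(2) by blast
qed

text \<open>Row \<open>k\<close> absorbs the rows below it one by one: the matrix with rows (u, v),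
  (-b, a) has determinant one and sends (g a, g b) to (g, 0).\<close>

lemma column_clear:
  assumes H: "hermite TYPE('a::comm_ring_1)"
  shows "\<exists>B. row_reach m k A B \<and> (\<forall>x. k < x \<and> x < m \<longrightarrow> B x l = (0 :: 'a))"
proof -
  have "t \<le> m \<Longrightarrow> \<exists>B. row_reach m k A B \<and> (\<forall>x. k < x \<and> x < t \<longrightarrow> B x l = 0)" for t
  proof (induction t)
    case 0
    then show ?case using row_reach.refl by blast
  next
    case (Suc t)
    then obtain B where B: "row_reach m k A B" "\<And>x. k < x \<Longrightarrow> x < t \<Longrightarrow> B x l = 0" by auto
    show ?case
    proof (cases "k < t")
      case False
      then show ?thesis using B by (intro exI[of _ B]) auto
    next
      case True
      obtain g a b u v where g: "B k l = g * a" "B t l = g * b" "u * a + v * b = 1"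
        using H unfolding hermite_def coprime_pair_def by metis
      have "row_reach m k A (row_op k t u v (- b) a B)"
        using B(1) True Suc.prems g(3) by (intro row_reach.row) auto
      moreover have "row_op k t u v (- b) a B x l = 0" if "k < x" "x < Suc t" for x
        using that B(2)[of x] True g by (auto simp: row_op_def algebra_simps less_Suc_eq)
      ultimately show ?thesis by blast
    qed
  qed
  then show ?thesis by blast
qed

text \<open>From row \<open>k\<close> on, columns \<open>k\<close> and \<open>l\<close> hold just h
  times a triangular matrix with rows (a, b), (0, d) and unimodular entries. Kaplansky's row (p, q)
  makes the top row h times a unimodular pair, a column operation turns the corner into h, and h
  then clears the entry below it.\<close>

lemma two_row_pivot:
  fixes B :: "nat \<Rightarrow> nat \<Rightarrow> 'a::comm_ring_1"
  assumes H: "hermite TYPE('a)" and K: "kaplansky_cond TYPE('a)"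
    and kl: "k < l" and km: "k + 1 < m"
    and col_k: "\<And>x. k < x \<Longrightarrow> x < m \<Longrightarrow> B x k = 0"
    and col_l: "\<And>x. k + 1 < x \<Longrightarrow> x < m \<Longrightarrow> B x l = 0"
  shows "\<exists>D. reach m (l + 1) k B D \<and> (\<forall>x. k < x \<and> x < m \<longrightarrow> D x k = 0) \<and>
           D k k dvd B k k \<and> D k k dvd B k l \<and> D k k dvd B (k + 1) l"
proof -
  obtain h a b d x y z where h: "B k k = h * a" "B k l = h * b" "B (k + 1) l = h * d"
    and xyz: "x * a + y * b + z * d = 1"
    using hermite_triple[OF H] by metis
  obtain p q where "coprime_pair p q" and "coprime_pair (p * a) (p * b + q * d)"
    using K xyz unfolding kaplansky_cond_def by blast
  then obtain \<alpha> \<beta> \<gamma> \<delta> where ab: "\<alpha> * p + \<beta> * q = 1" and lm: "\<gamma> * (p * a) + \<delta> * (p * b + q * d) = 1"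
    unfolding coprime_pair_def by blast
  \<comment> \<open>The Bezout relations for (p, q) and for the new top row complete both to
    matrices of determinant one.\<close>
  define R where "R = row_op k (k + 1) p q (- \<beta>) \<alpha> B"
  define C where "C = col_op k l \<gamma> \<delta> (- (p * b + q * d)) (p * a) R"
  \<comment> \<open>The entry of \<open>C\<close> below the corner is h times t, so subtracting t
    times the top row removes it.\<close>
  define t where "t = \<gamma> * (- (\<beta> * a)) + \<delta> * (\<alpha> * d - \<beta> * b)"
  define D where "D = row_op k (k + 1) 1 0 (- t) 1 C"
  have R: "R k k = h * (p * a)" "R k l = h * (p * b + q * d)" "R (k + 1) k = h * (- (\<beta> * a))"
    "R (k + 1) l = h * (\<alpha> * d - \<beta> * b)"
    using col_k[of "k + 1"] km h by (simp_all add: R_def row_op_def algebra_simps)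
  have "C k k = h * (\<gamma> * (p * a) + \<delta> * (p * b + q * d))"
    using kl by (simp add: C_def col_op_def R algebra_simps)
  then have Ckk: "C k k = h" using lm by simp
  have Ck1: "C (k + 1) k = h * t"
    using kl by (simp add: C_def col_op_def R[unfolded Suc_eq_plus1[symmetric]] algebra_simps t_def)
  have "reach m (l + 1) k B R"
    unfolding R_def using km ab by (intro reach.row reach.refl) (auto simp: algebra_simps)
  then have "reach m (l + 1) k B C"
    unfolding C_def using kl lm by (intro reach.col) (auto simp: algebra_simps)
  then have "reach m (l + 1) k B D"
    unfolding D_def using km by (intro reach.row) auto
  moreover have "D x k = 0" if "k < x" "x < m" for x
  proof (cases "x = k + 1")
    case True
    then show ?thesis using Ck1 Ckk by (simp add: D_def row_op_def)
  next
    case False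
    then have "R x k = 0" "R x l = 0" using that col_k col_l by (simp_all add: R_def row_op_def)
    then show ?thesis using that False kl by (simp add: D_def row_op_def C_def col_op_def)
  qed
  moreover have "D k k = h" using Ckk by (simp add: D_def row_op_def)
  ultimately show ?thesis using h by (intro exI[of _ D]) auto
qed

text \<open>Induction on the exclusive column bound \<open>l\<close>. Absorbing one more column
  replaces the pivot by a divisor of it, so earlier columns remain divisible.\<close>

lemma pivot_columns:
  fixes A :: "nat \<Rightarrow> nat \<Rightarrow> 'a::comm_ring_1"
  assumes H: "hermite TYPE('a)" and K: "kaplansky_cond TYPE('a)" and km: "k < m"
    and "k < l" "l \<le> n"
  shows "\<exists>B. reach m n k A B \<and> (\<forall>x. k < x \<and> x < m \<longrightarrow> B x k = 0) \<and>
           (\<forall>x y. k \<le> x \<and> x < m \<and> k \<le> y \<and> y < l \<longrightarrow> B k k dvd B x y)"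
  using assms(4,5)
proof (induction l)
  case (Suc l)
  show ?case
  proof (cases "l = k")
    case True
    obtain B where B: "row_reach m k A B" "\<And>x. k < x \<Longrightarrow> x < m \<Longrightarrow> B x k = 0"
      using column_clear[OF H, of m k A k] by blast
    have "B k k dvd B x y" if "k \<le> x" "x < m" "k \<le> y" "y < Suc l" for x y
      using that B(2)[of x] True by (cases "x = k"; cases "y = k") auto
    then show ?thesis using B row_reach_imp_reach[OF B(1), of k n] by blast
  next
    case False
    then have kl: "k < l" using Suc.prems by simp
    then obtain B where B: "reach m n k A B" "\<And>x. k < x \<Longrightarrow> x < m \<Longrightarrow> B x k = 0"
      "\<And>x y. k \<le> x \<Longrightarrow> x < m \<Longrightarrow> k \<le> y \<Longrightarrow> y < l \<Longrightarrow> B k k dvd B x y"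
      using Suc by auto
    show ?thesis
    proof (cases "k + 1 < m")
      \<comment> \<open>Row \<open>k\<close> is the last row, and the Hermite property alone merges
        the new entry into the pivot.\<close>
      case False
      then have m: "m = k + 1" using km by simp
      obtain h a b u v where g: "B k k = h * a" "B k l = h * b" "u * a + v * b = 1"
        using H unfolding hermite_def coprime_pair_def by metis
      define C where "C = col_op k l u v (- b) a B"
      have "reach m n k A C"
        unfolding C_def using B(1) kl Suc.prems g(3) by (intro reach.col) auto
      moreover have "C k k = h * (u * a + v * b)" by (simp add: C_def col_op_def g(1,2) algebra_simps)
      then have h: "C k k = h" using g(3) by simp
      moreover have "h dvd B k y" if "k \<le> y" "y < Suc l" for y
        using that B(3)[of k y] g km by (cases "y = l") (auto intro: dvd_mult_left)
      then have "h dvd C k y" if "k \<le> y" "y < Suc l" for y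
        using that kl by (simp add: C_def col_op_def)
      ultimately show ?thesis using m by (intro exI[of _ C]) (auto simp: le_less_Suc_eq)
    next
      case True
      \<comment> \<open>Only rows below \<open>k\<close> are used, so the pivot row and the zeros of
        column \<open>k\<close> survive, while column \<open>l\<close> keeps at most rows
        \<open>k\<close> and \<open>k + 1\<close> of the block.\<close>
      obtain B' where R: "row_reach m (k + 1) B B'" "\<And>x. k + 1 < x \<Longrightarrow> x < m \<Longrightarrow> B' x l = 0"
        using column_clear[OF H, of m "k + 1" B l] by blast
      have top: "B' k y = B k y" for y using row_reach_above[OF R(1)] by simp
      have dv: "e dvd B' x y" if "\<And>x. k < x \<Longrightarrow> x < m \<Longrightarrow> e dvd B x y" "k < x" "x < m" for e x y
        by (rule row_reach_dvd[OF R(1)]) (use that in auto)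
      have col: "B' x k = 0" if "k < x" "x < m" for x
        using dv[where e = 0 and x = x and y = k] that B(2) by simp
      obtain D where D: "reach m (l + 1) k B' D" "\<And>x. k < x \<Longrightarrow> x < m \<Longrightarrow> D x k = 0"
        "D k k dvd B' k k" "D k k dvd B' k l" "D k k dvd B' (k + 1) l"
        using two_row_pivot[OF H K kl True, of B'] col R(2) by blast
      \<comment> \<open>It suffices to divide the block of \<open>B'\<close>, since \<open>D\<close>
        arises from it by operations inside this block.\<close>
      have "D k k dvd B' x y" if "k \<le> x" "x < m" "k \<le> y" "y < l + 1" for x y
      proof (cases "y = l")
        case True
        then show ?thesis using D(4,5) R(2)[of x] that
          by (cases "x = k"; cases "x = k + 1") auto
      next
        case False
        have "B k k dvd B x' y" if "k \<le> x'" "x' < m" for x'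
          using that \<open>k \<le> y\<close> \<open>y < l + 1\<close> False by (intro B(3)) auto
        then have "B k k dvd B' x y" using dv[where e = "B k k" and x = x and y = y] that top[of y]
          by (cases "x = k") auto
        then show ?thesis using D(3) top[of k] by (auto intro: dvd_trans)
      qed
      then have "D k k dvd D x y" if "k \<le> x" "x < m" "k \<le> y" "y < l + 1" for x y
        using reach_dvd[OF D(1), of "D k k"] that by blast
      moreover have "reach m n k A D"
        using reach_trans[OF reach_trans[OF reach_mono[OF D(1), of n k]
              row_reach_imp_reach[OF R(1), of k n]] B(1)] Suc.prems by simp
      ultimately show ?thesis using D(2) by (intro exI[of _ D]) auto
    qed
  qed
qed simp

lemma row_clear:
  assumes "k < n" and piv: "\<And>y. k \<le> y \<Longrightarrow> y < n \<Longrightarrow> A k k dvd A k y"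
  shows "\<exists>B. reach m n k A B \<and> (\<forall>x. B x k = A x k) \<and> (\<forall>y. k < y \<and> y < n \<longrightarrow> B k y = 0)"
proof -
  \<comment> \<open>The last conjunct keeps columns from \<open>t\<close> on untouched in row
    \<open>k\<close>, so quotients taken in \<open>A\<close> still apply.\<close>
  have "t \<le> n \<Longrightarrow> \<exists>B. reach m n k A B \<and> (\<forall>x. B x k = A x k) \<and>
      (\<forall>y. k < y \<and> y < t \<longrightarrow> B k y = 0) \<and> (\<forall>y. t \<le> y \<longrightarrow> B k y = A k y)" for t
  proof (induction t)
    case 0
    then show ?case using reach.refl by blast
  next
    case (Suc t)
    then obtain B where B: "reach m n k A B" "\<And>x. B x k = A x k"
      "\<And>y. k < y \<Longrightarrow> y < t \<Longrightarrow> B k y = 0" "\<And>y. t \<le> y \<Longrightarrow> B k y = A k y" by auto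
    show ?case
    proof (cases "k < t")
      case False
      then show ?thesis using B by (intro exI[of _ B]) auto
    next
      case True
      then obtain c where c: "A k t = A k k * c" using piv[of t] Suc.prems by (auto elim: dvdE)
      define C where "C = col_op k t 1 0 (- c) 1 B"
      have "reach m n k A C"
        unfolding C_def using B(1) True Suc.prems by (intro reach.col) auto
      moreover have "C k y = 0" if "k < y" "y < Suc t" for y
        using that B(2)[of k] B(3)[of y] B(4)[of t] c True
        by (auto simp: C_def col_op_def less_Suc_eq)
      moreover have "C x k = A x k" for x using B(2) by (simp add: C_def col_op_def)
      moreover have "C k y = A k y" if "Suc t \<le> y" for y
        using that B(4) True by (simp add: C_def col_op_def)
      ultimately show ?thesis by blast
    qed
  qed
  then show ?thesis by blast
qed

text \<open>Once the pivot divides the block, clearing its row leaves column \<open>k\<close> alone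
  and stays inside the block, so zeros and divisibility persist.\<close>

lemma pivot:
  fixes A :: "nat \<Rightarrow> nat \<Rightarrow> 'a::comm_ring_1"
  assumes H: "hermite TYPE('a)" and K: "kaplansky_cond TYPE('a)" and "k < m" "k < n"
  shows "\<exists>B. reach m n k A B \<and> (\<forall>x. k < x \<and> x < m \<longrightarrow> B x k = 0) \<and>
           (\<forall>y. k < y \<and> y < n \<longrightarrow> B k y = 0) \<and>
           (\<forall>x y. k \<le> x \<and> x < m \<and> k \<le> y \<and> y < n \<longrightarrow> B k k dvd B x y)"
proof -
  obtain B where B: "reach m n k A B" "\<And>x. k < x \<Longrightarrow> x < m \<Longrightarrow> B x k = 0"
    "\<And>x y. k \<le> x \<Longrightarrow> x < m \<Longrightarrow> k \<le> y \<Longrightarrow> y < n \<Longrightarrow> B k k dvd B x y"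
    using pivot_columns[OF H K assms(3) assms(4) order.refl, of A] by blast
  obtain C where C: "reach m n k B C" "\<And>x. C x k = B x k" "\<And>y. k < y \<Longrightarrow> y < n \<Longrightarrow> C k y = 0"
    using row_clear[OF assms(4), of B m] B(3) assms(3) by auto
  have "C k k dvd C x y" if "k \<le> x" "x < m" "k \<le> y" "y < n" for x y
    using reach_dvd[OF C(1), of "B k k"] that B(3) C(2) by simp
  then show ?thesis using reach_trans[OF C(1) B(1)] B(2) C(2,3) by (intro exI[of _ C]) auto
qed

text \<open>The invariant lets each pivot divide its whole trailing block, not just the next pivot,
  because this form survives all later operations in that block.\<close>

lemma partial_diagonal_reduction:
  fixes A :: "nat \<Rightarrow> nat \<Rightarrow> 'a::comm_ring_1"
  assumes H: "hermite TYPE('a)" and K: "kaplansky_cond TYPE('a)" and "k \<le> min m n"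
  shows "\<exists>B. reach m n 0 A B \<and>
           (\<forall>x y. x < m \<and> y < n \<and> x \<noteq> y \<and> (x < k \<or> y < k) \<longrightarrow> B x y = 0) \<and>
           (\<forall>i x y. i < k \<and> i \<le> x \<and> x < m \<and> i \<le> y \<and> y < n \<longrightarrow> B i i dvd B x y)"
  using assms(3)
proof (induction k)
  case 0
  then show ?case using reach.refl by blast
next
  case (Suc k)
  then obtain B where B: "reach m n 0 A B"
    "\<And>x y. x < m \<Longrightarrow> y < n \<Longrightarrow> x \<noteq> y \<Longrightarrow> x < k \<or> y < k \<Longrightarrow> B x y = 0"
    "\<And>i x y. i < k \<Longrightarrow> i \<le> x \<Longrightarrow> x < m \<Longrightarrow> i \<le> y \<Longrightarrow> y < n \<Longrightarrow> B i i dvd B x y"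
    by auto
  have kmn: "k < m" "k < n" using Suc.prems by auto
  obtain C where C: "reach m n k B C" "\<And>x. k < x \<Longrightarrow> x < m \<Longrightarrow> C x k = 0"
    "\<And>y. k < y \<Longrightarrow> y < n \<Longrightarrow> C k y = 0"
    "\<And>x y. k \<le> x \<Longrightarrow> x < m \<Longrightarrow> k \<le> y \<Longrightarrow> y < n \<Longrightarrow> C k k dvd C x y"
    using pivot[OF H K kmn, of B] by blast
  have old: "C x y = 0" if xy: "x < m" "y < n" "x \<noteq> y" "x < k \<or> y < k" for x y
  proof -
    consider "x < k" "y < k" | "x < k" "k \<le> y" | "k \<le> x" "y < k" using xy(4) by linarith
    then show ?thesis
    proof cases
      case 1
      then show ?thesis using reach_outside[OF C(1) 1] B(2) xy by simp
    next
      case 2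
      show ?thesis by (rule reach_zero_right[OF C(1) 2(1) _ 2(2) xy(2)]) (use B(2) 2 xy in auto)
    next
      case 3
      show ?thesis by (rule reach_zero_below[OF C(1) 3(2) _ 3(1) xy(1)]) (use B(2) 3 xy in auto)
    qed
  qed
  have "C x y = 0" if "x < m" "y < n" "x \<noteq> y" "x < Suc k \<or> y < Suc k" for x y
    using that old[of x y] C(2)[of x] C(3)[of y] by (metis less_Suc_eq linorder_neqE_nat)
  moreover have "C i i dvd C x y" if "i < Suc k" "i \<le> x" "x < m" "i \<le> y" "y < n" for i x y
  proof (cases "i = k")
    case True
    then show ?thesis using C(4) that by simp
  next
    case False
    then have ik: "i < k" using that by simp
    have Ci: "C i i = B i i" using reach_outside[OF C(1) ik ik] .
    \<comment> \<open>The trailing block inherits divisibility, the settled corner is unchanged, and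
      every other position is an off-diagonal zero.\<close>
    consider "k \<le> x" "k \<le> y" | "x < k" "y < k" | "x \<noteq> y" "x < k \<or> y < k" by linarith
    then show ?thesis
    proof cases
      case 1
      show ?thesis unfolding Ci
        by (rule reach_dvd[OF C(1)]) (use 1 that ik B(3) in auto)
    next
      case 2
      then show ?thesis unfolding Ci reach_outside[OF C(1) 2] using B(3) that ik by simp
    next
      case 3
      then show ?thesis using old that by simp
    qed
  qed
  ultimately show ?case
    using reach_trans[OF reach_mono[OF C(1), of n 0] B(1)] by (intro exI[of _ C]) auto
qed

text \<open>Reduction up to \<open>min m n\<close> is complete: the smaller index of an off-diagonal
  position lies below both dimensions, and each diagonal entry lies in the trailing block of its
  predecessor.\<close>

theorem hermite_kaplansky_imp_elementary_divisor_ring: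
  assumes H: "hermite TYPE('a::comm_ring_1)" and K: "kaplansky_cond TYPE('a)"
  shows "elementary_divisor_ring TYPE('a)"
  unfolding elementary_divisor_ring_def
proof (intro allI impI ballI)
  fix m n :: nat and M :: "'a mat"
  assume M: "M \<in> carrier_mat m n"
  then have fM: "fmat m n (\<lambda>i j. M $$ (i, j)) = M" by (intro eq_matI) (auto simp: fmat_def)
  obtain B where B: "reach m n 0 (\<lambda>i j. M $$ (i, j)) B"
    "\<And>x y. x < m \<Longrightarrow> y < n \<Longrightarrow> x \<noteq> y \<Longrightarrow> x < min m n \<or> y < min m n \<Longrightarrow> B x y = 0"
    "\<And>i x y. i < min m n \<Longrightarrow> i \<le> x \<Longrightarrow> x < m \<Longrightarrow> i \<le> y \<Longrightarrow> y < n \<Longrightarrow> B i i dvd B x y"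
    using partial_diagonal_reduction[OF H K order.refl, of m n "\<lambda>i j. M $$ (i, j)"] by auto
  have "equivalent_mat M (fmat m n B)" using reach_equivalent[OF B(1)] fM by simp
  moreover have "diagonal_mat (fmat m n B)"
    unfolding diagonal_mat_def by (auto simp: fmat_def intro!: B(2))
  moreover have "fmat m n B $$ (i, i) dvd fmat m n B $$ (i + 1, i + 1)" if "i + 1 < min m n" for i
    using that by (auto simp: fmat_def intro!: B(3))
  ultimately show "\<exists>D. equivalent_mat M D \<and> diagonal_mat D \<and>
      (\<forall>i. i + 1 < min m n \<longrightarrow> D $$ (i, i) dvd D $$ (i + 1, i + 1))" by blast
qed

theorem mainTheorem10:
  assumes "SU2_ring TYPE('a::comm_ring_1)"
  shows "((\<forall>a b c :: 'a. vec_of_list [a, b, c] \<in> Um 3 \<longrightarrow>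
             (\<exists>e f :: 'a. vec_of_list [a * e^2 - c * f^2, a * c - b^2] \<in> Um 2))
           \<longrightarrow> elementary_divisor_ring TYPE('a)) \<and>
         (CHAR('a) = 2 \<longrightarrow> elementary_divisor_ring TYPE('a) \<longrightarrow>
           (\<forall>a b c :: 'a. vec_of_list [a, b, c] \<in> Um 3 \<longrightarrow>
             (\<exists>e f :: 'a. vec_of_list [a * e^2 - c * f^2, a * c - b^2] \<in> Um 2)))"
  unfolding Um2_iff Um3_iff
  using SU2_imp_hermite[OF assms] SU2_imp_kaplansky_cond[OF assms]
    hermite_kaplansky_imp_elementary_divisor_ring char2_converse
  by blast

end
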